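(* Let $m=n+2$. Then every instance with $n$ agents with monotone valuations and $m$ goods has at least $n$ EFX allocations. *)

theory Defs
  imports Complex_Main
begin

definition monotone_valuation :: "'g set \<Rightarrow> ('g set \<Rightarrow> real) \<Rightarrow> bool" where
  "monotone_valuation M u \<longleftrightarrow> (\<forall>S T. S \<subseteq> T \<and> T \<subseteq> M \<longrightarrow> u S \<le> u T)"

text \<open>A (complete) allocation of the goods M to agents 0..<n: pairwise disjoint bundles
  covering M; bundles of non-agents are empty (so allocations are uniquely represented).\<close>

definition is_allocation :: "nat \<Rightarrow> 'g set \<Rightarrow> (nat \<Rightarrow> 'g set) \<Rightarrow> bool" where
  "is_allocation n M X \<longleftrightarrow>
     (\<forall>i<n. X i \<subseteq> M) \<and>
     (\<forall>i<n. \<forall>j<n. i \<noteq> j \<longrightarrow> X i \<inter> X j = {}) \<and>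
     (\<Union>i<n. X i) = M \<and>
     (\<forall>i\<ge>n. X i = {})"

definition EFX :: "nat \<Rightarrow> (nat \<Rightarrow> 'g set \<Rightarrow> real) \<Rightarrow> (nat \<Rightarrow> 'g set) \<Rightarrow> bool" where
  "EFX n v X \<longleftrightarrow>
     (\<forall>i<n. \<forall>j<n. \<forall>g\<in>X j. v i (X j - {g}) \<le> v i (X i))"

definition EFX_allocations :: "nat \<Rightarrow> 'g set \<Rightarrow> (nat \<Rightarrow> 'g set \<Rightarrow> real) \<Rightarrow> (nat \<Rightarrow> 'g set) set" where
  "EFX_allocations n M v = {X. is_allocation n M X \<and> EFX n v X}"

end

theory Submission
  imports Defs
begin

text \<open>Ties between single goods can be broken, so each agent ranks the goods strictly. In an EFX
  allocation without empty bundles the surpluses \<open>card (X i) - 1\<close> add up to 2, so it suffices that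
  the surpluses of all agents over all such allocations add up to \<open>2 * n\<close>.

  Let \<open>n \<ge> 3\<close> and let agent \<open>s\<close> have total surplus at most 1. Then some agent \<open>j\<close> never gets a pair
  together with \<open>s\<close>. Assign one good to each agent except \<open>s\<close> and \<open>j\<close> in a Pareto optimal way. Four
  goods are left, and since no split of them into two pairs works, one of them, \<open>t\<close>, is worth more
  to \<open>s\<close> and to \<open>j\<close> than any pair of the other three goods \<open>R\<close>. Choose \<open>j\<close> and the assignment such
  that \<open>t\<close> is as bad as possible for \<open>s\<close>. If no agent envies a pair in \<open>R\<close>, then \<open>s\<close> can take
  \<open>R\<close>. An agent \<open>k\<close> who envies a pair in \<open>R\<close> shares some EFX allocation into pairs with \<open>s\<close>, as
  otherwise \<open>k\<close> could replace \<open>j\<close> with a worse \<open>t\<close>; hence \<open>k\<close> is unique. If some assigned agent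
  is envied by nobody, \<open>s\<close> obtains a second pair. Otherwise every agent is reachable from \<open>s\<close> by
  envy, and shifting goods along a path from \<open>s\<close> to \<open>k\<close> lets \<open>k\<close> take \<open>R\<close>. So each deficient
  agent \<open>s\<close> has a partner \<open>k\<close> with surplus 2 from \<open>R\<close> plus 1 for each deficient agent it serves,
  which makes up for all deficits.\<close>

lemma finite_EFX_allocations:
  assumes "finite M"
  shows "finite (EFX_allocations n M v)"
proof (rule finite_subset)
  show "EFX_allocations n M v \<subseteq> {f. \<forall>i. (i \<in> {..<n} \<longrightarrow> f i \<in> Pow M) \<and> (i \<notin> {..<n} \<longrightarrow> f i = {})}"
    unfolding EFX_allocations_def is_allocation_def by auto
  show "finite {f. \<forall>i. (i \<in> {..<n} \<longrightarrow> f i \<in> Pow M) \<and> (i \<notin> {..<n} \<longrightarrow> f i = {})}"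
    by (rule finite_set_of_finite_funs) (use assms in auto)
qed

subsection \<open>Allocations with nonempty bundles\<close>

locale strict_instance =
  fixes n :: nat and M :: "'g set" and v :: "nat \<Rightarrow> 'g set \<Rightarrow> real"
  assumes finite_goods: "finite M"
    and card_goods: "card M = n + 2"
    and monotone: "\<And>i. i < n \<Longrightarrow> monotone_valuation M (v i)"
    and inj_singleton: "\<And>i. i < n \<Longrightarrow> inj_on (\<lambda>h. v i {h}) M"
begin

abbreviation u :: "nat \<Rightarrow> 'g \<Rightarrow> real" where "u i h \<equiv> v i {h}"

definition proper :: "(nat \<Rightarrow> 'g set) set" where
  "proper = {X \<in> EFX_allocations n M v. \<forall>i<n. X i \<noteq> {}}"

text \<open>Truncated subtraction is exact for agents \<open>i < n\<close>, since their bundles in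
  proper allocations are finite and nonempty.\<close>

definition surplus :: "nat \<Rightarrow> nat" where
  "surplus i = (\<Sum>X\<in>proper. card (X i) - 1)"

definition config :: "nat set \<Rightarrow> (nat \<Rightarrow> 'g) \<Rightarrow> bool" where
  "config A g \<longleftrightarrow> inj_on g A \<and> g ` A \<subseteq> M"

text \<open>Alternatives may use every good of \<open>M\<close>, also those that \<open>g\<close>
  leaves over, so the notion excludes both trades inside \<open>A\<close> and swaps with
  leftovers.\<close>

definition pareto :: "nat set \<Rightarrow> (nat \<Rightarrow> 'g) \<Rightarrow> bool" where
  "pareto A g \<longleftrightarrow> config A g \<and>
     (\<forall>g'. config A g' \<and> (\<forall>a\<in>A. u a (g a) \<le> u a (g' a)) \<longrightarrow> (\<forall>a\<in>A. u a (g' a) = u a (g a)))"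

definition bad_pair :: "nat \<Rightarrow> nat \<Rightarrow> bool" where
  "bad_pair s j \<longleftrightarrow> \<not> (\<exists>X\<in>proper. card (X s) = 2 \<and> card (X j) = 2)"

text \<open>In use, \<open>L\<close> consists of the four goods left when all agents but two hold
  one good each; \<open>Q\<close> then runs through the three pairs avoiding
  \<open>t\<close>.\<close>

definition dominant :: "nat \<Rightarrow> 'g set \<Rightarrow> 'g \<Rightarrow> bool" where
  "dominant i L t \<longleftrightarrow> (\<forall>Q. Q \<subseteq> L - {t} \<and> card Q = 2 \<longrightarrow> v i Q < u i t)"

lemma valuation_mono: "i < n \<Longrightarrow> S \<subseteq> T \<Longrightarrow> T \<subseteq> M \<Longrightarrow> v i S \<le> v i T"
  using monotone unfolding monotone_valuation_def by blast

lemma u_le_bundle: "i < n \<Longrightarrow> h \<in> T \<Longrightarrow> T \<subseteq> M \<Longrightarrow> u i h \<le> v i T"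
  by (rule valuation_mono) auto

lemma u_eq_imp_eq: "i < n \<Longrightarrow> h \<in> M \<Longrightarrow> k \<in> M \<Longrightarrow> u i h = u i k \<Longrightarrow> h = k"
  using inj_singleton unfolding inj_on_def by blast

lemma finite_proper: "finite proper"
  unfolding proper_def using finite_EFX_allocations[OF finite_goods] by simp

lemma finite_bundle: "X \<in> proper \<Longrightarrow> i < n \<Longrightarrow> finite (X i)"
  unfolding proper_def EFX_allocations_def is_allocation_def using finite_goods
  by (auto intro: finite_subset)

lemma card_bundle_pos: "X \<in> proper \<Longrightarrow> i < n \<Longrightarrow> card (X i) \<ge> 1"
  using finite_bundle[of X i] unfolding proper_def by (simp add: Suc_le_eq card_gt_0_iff)

section \<open>Counting surpluses\<close>

lemma sum_bundle_surplus:
  assumes "X \<in> proper"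
  shows "(\<Sum>i<n. card (X i) - 1) = 2"
proof -
  have "(\<Sum>i<n. card (X i)) = card (\<Union>i<n. X i)"
    using assms finite_bundle[OF assms]
    by (subst card_UN_disjoint) (auto simp: proper_def EFX_allocations_def is_allocation_def)
  also have "\<dots> = n + 2"
    using assms card_goods by (simp add: proper_def EFX_allocations_def is_allocation_def)
  finally have "(\<Sum>i<n. card (X i)) = n + 2" .
  moreover have "(\<Sum>i<n. card (X i)) = (\<Sum>i<n. (card (X i) - 1) + 1)"
    by (intro sum.cong) (use card_bundle_pos[OF assms] in fastforce)+
  ultimately show ?thesis by (simp only: sum.distrib) simp
qed

lemma sum_surplus: "(\<Sum>i<n. surplus i) = 2 * card proper"
proof -
  have "(\<Sum>i<n. surplus i) = (\<Sum>X\<in>proper. \<Sum>i<n. card (X i) - 1)"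
    unfolding surplus_def by (rule sum.swap)
  also have "\<dots> = (\<Sum>X\<in>proper. 2)" using sum_bundle_surplus by (intro sum.cong) auto
  finally show ?thesis by simp
qed

lemma surplus_ge_sum: "F \<subseteq> proper \<Longrightarrow> (\<Sum>X\<in>F. card (X i) - 1) \<le> surplus i"
  unfolding surplus_def by (rule sum_mono2[OF finite_proper]) auto

lemma surplus_ge_two_pairs:
  assumes "X \<in> proper" "Y \<in> proper" "X \<noteq> Y" "card (X i) = 2" "card (Y i) = 2"
  shows "surplus i \<ge> 2"
  using surplus_ge_sum[of "{X, Y}" i] assms by simp

lemma surplus_ge_triple:
  assumes "X \<in> proper" "card (X i) = 3"
  shows "surplus i \<ge> 2"
  using surplus_ge_sum[of "{X}" i] assms by simp

text \<open>Three pairs would contribute 3 to a total surplus of 2.\<close>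

lemma no_three_large:
  assumes "X \<in> proper" "a < n" "b < n" "c < n" "a \<noteq> b" "a \<noteq> c" "b \<noteq> c"
    and "card (X a) = 2" "card (X b) = 2"
  shows "card (X c) \<noteq> 2"
proof
  assume c: "card (X c) = 2"
  have "(\<Sum>i\<in>{a,b,c}. card (X i) - 1) \<le> (\<Sum>i<n. card (X i) - 1)"
    by (rule sum_mono2) (use assms in auto)
  then show False using assms c sum_bundle_surplus[OF assms(1)] by simp
qed

text \<open>\<open>X = Y\<close> would put three pairs into one allocation, so \<open>s\<close>
  holds pairs in two different allocations. Hence an agent with surplus at most 1 shares pairs with
  at most one other agent.\<close>

lemma surplus_ge_two_partners:
  assumes "X \<in> proper" "Y \<in> proper" "s < n" "a < n" "b < n" "s \<noteq> a" "s \<noteq> b" "a \<noteq> b"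
    and "card (X s) = 2" "card (X a) = 2" "card (Y s) = 2" "card (Y b) = 2"
  shows "surplus s \<ge> 2"
  using no_three_large[of X s a b] surplus_ge_two_pairs[of X Y s] assms by metis

section \<open>EFX criteria for two pairs or one triple\<close>

text \<open>A pair minus one good is a single good, and a one-good bundle minus its good is empty,
  so it suffices to compare the single goods of the pairs with the other agents' own
  bundles.\<close>

lemma two_pairs_proper:
  assumes ab: "a < n" "b < n" "a \<noteq> b"
    and g: "config ({..<n} - {a,b}) g"
    and PQ: "P \<union> Q = M - g ` ({..<n} - {a,b})" "P \<inter> Q = {}" "card P = 2" "card Q = 2"
    and others: "\<And>i h. i < n \<Longrightarrow> i \<noteq> a \<Longrightarrow> i \<noteq> b \<Longrightarrow> h \<in> P \<union> Q \<Longrightarrow> u i h \<le> u i (g i)"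
    and a: "\<And>h. h \<in> Q \<Longrightarrow> u a h \<le> v a P"
    and b: "\<And>h. h \<in> P \<Longrightarrow> u b h \<le> v b Q"
  shows "(\<lambda>i. if i = a then P else if i = b then Q else if i < n then {g i} else {}) \<in> proper"
    (is "?X \<in> proper")
proof -
  have gM: "g i \<in> M" if "i < n" "i \<noteq> a" "i \<noteq> b" for i
    using g that unfolding config_def by auto
  have gPQ: "g i \<notin> P" "g i \<notin> Q" if "i < n" "i \<noteq> a" "i \<noteq> b" for i
    using PQ(1) that by auto
  have sub: "P \<subseteq> M" "Q \<subseteq> M" using PQ(1) by auto
  have XM: "?X i \<subseteq> M" if "i < n" for i using that gM sub by auto
  have "(\<Union>i<n. ?X i) = M"
  proof
    show "(\<Union>i<n. ?X i) \<subseteq> M" using XM by blast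
    show "M \<subseteq> (\<Union>i<n. ?X i)"
    proof
      fix h assume h: "h \<in> M"
      show "h \<in> (\<Union>i<n. ?X i)"
      proof (cases "h \<in> P \<union> Q")
        case True
        then have "h \<in> ?X a \<or> h \<in> ?X b" using ab by auto
        then show ?thesis using ab by blast
      next
        case False
        then obtain i where "i < n" "i \<noteq> a" "i \<noteq> b" "h = g i" using h PQ(1) by auto
        then have "h \<in> ?X i" "i \<in> {..<n}" by auto
        then show ?thesis by blast
      qed
    qed
  qed
  moreover have ginj: "g i \<noteq> g j"
    if "i < n" "i \<noteq> a" "i \<noteq> b" "j < n" "j \<noteq> a" "j \<noteq> b" "i \<noteq> j" for i j
    using that g unfolding config_def inj_on_def by blast
  then have "?X i \<inter> ?X j = {}" if "i < n" "j < n" "i \<noteq> j" for i j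
    using that gPQ PQ(2) by (simp add: Int_commute)
  ultimately have al: "is_allocation n M ?X"
    using XM ab unfolding is_allocation_def by simp
  have pair: "\<exists>h\<in>T. T - {p} = {h}" if "card T = 2" "p \<in> T" for T :: "'g set" and p
    using that by (auto simp: card_2_iff)
  have "v i (?X j - {p}) \<le> v i (?X i)" if ij: "i < n" "j < n" and p: "p \<in> ?X j" for i j p
  proof (cases "i = j \<or> (j \<noteq> a \<and> j \<noteq> b)")
    case True
    then have "?X j - {p} \<subseteq> ?X i" using p ij by auto
    then show ?thesis using XM ij by (intro valuation_mono) auto
  next
    case False
    then obtain h where "h \<in> ?X j" "?X j - {p} = {h}"
      using pair[OF PQ(3)] pair[OF PQ(4)] p by (metis (full_types))
    then show ?thesis using False others[of i h] a[of h] b[of h] ab ij by (auto split: if_splits)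
  qed
  then have "EFX n v ?X" unfolding EFX_def by blast
  moreover have "P \<noteq> {}" "Q \<noteq> {}" using PQ by auto
  ultimately show ?thesis using al unfolding proper_def EFX_allocations_def by auto
qed

text \<open>Only the bundle of \<open>a\<close> can cause envy, and \<open>R\<close> minus one good
  is a pair. The size 3 is what remains of \<open>n + 2\<close> goods after \<open>n - 1\<close> are
  handed out.\<close>

lemma triple_proper:
  assumes a: "a < n"
    and g: "config ({..<n} - {a}) g"
    and R: "R = M - g ` ({..<n} - {a})"
    and others: "\<And>i T. i < n \<Longrightarrow> i \<noteq> a \<Longrightarrow> T \<subseteq> R \<Longrightarrow> card T = 2 \<Longrightarrow> v i T \<le> u i (g i)"
  shows "(\<lambda>i. if i = a then R else if i < n then {g i} else {}) \<in> proper" (is "?X \<in> proper")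
    and "card R = 3"
proof -
  have gM: "g i \<in> M" if "i < n" "i \<noteq> a" for i
    using g that unfolding config_def by auto
  have gR: "g i \<notin> R" if "i < n" "i \<noteq> a" for i
    using R that by auto
  have sub: "R \<subseteq> M" using R by auto
  have "card (g ` ({..<n} - {a})) = n - 1"
    using g a unfolding config_def by (simp add: card_image)
  then have "card R = (n + 2) - (n - 1)"
    unfolding R using g finite_goods card_goods unfolding config_def
    by (subst card_Diff_subset) auto
  then show R3: "card R = 3" using a by simp
  have XM: "?X i \<subseteq> M" if "i < n" for i using that gM sub by auto
  have "(\<Union>i<n. ?X i) = M"
  proof
    show "(\<Union>i<n. ?X i) \<subseteq> M" using XM by blast
    show "M \<subseteq> (\<Union>i<n. ?X i)"
    proof
      fix h assume h: "h \<in> M"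
      show "h \<in> (\<Union>i<n. ?X i)"
      proof (cases "h \<in> R")
        case True
        then show ?thesis using a by auto
      next
        case False
        then obtain i where "i < n" "i \<noteq> a" "h = g i" using h R by auto
        then have "h \<in> ?X i" "i \<in> {..<n}" by auto
        then show ?thesis by blast
      qed
    qed
  qed
  moreover have ginj: "g i \<noteq> g j" if "i < n" "i \<noteq> a" "j < n" "j \<noteq> a" "i \<noteq> j" for i j
    using that g unfolding config_def inj_on_def by blast
  then have "?X i \<inter> ?X j = {}" if "i < n" "j < n" "i \<noteq> j" for i j
    using that gR by simp
  ultimately have al: "is_allocation n M ?X"
    using XM a unfolding is_allocation_def by simp
  have "v i (?X j - {p}) \<le> v i (?X i)" if ij: "i < n" "j < n" and p: "p \<in> ?X j" for i j p
  proof (cases "i = j \<or> j \<noteq> a")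
    case True
    then have "?X j - {p} \<subseteq> ?X i" using p ij by auto
    then show ?thesis using XM ij by (intro valuation_mono) auto
  next
    case False
    then have "p \<in> R" using p by simp
    then have "card (R - {p}) = 2" using R3 by simp
    then show ?thesis using False others[of i "R - {p}"] ij by auto
  qed
  then have "EFX n v ?X" unfolding EFX_def by blast
  moreover have "R \<noteq> {}" using R3 by auto
  ultimately show "?X \<in> proper" using al unfolding proper_def EFX_allocations_def by auto
qed

subsection \<open>Pareto optimal assignments of single goods\<close>

lemma pareto_exists:
  assumes g0: "config A g0" and A: "A \<subseteq> {..<n}"
  obtains g where "pareto A g" "\<And>a. a \<in> A \<Longrightarrow> u a (g0 a) \<le> u a (g a)"
proof -
  \<comment> \<open>\<open>r\<close> adds up the ranks of the assigned goods. It is a bounded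
    natural number, so a maximum exists although \<open>g\<close> is unrestricted outside
    \<open>A\<close>; any Pareto improvement would raise it.\<close>
  define r where "r g = (\<Sum>a\<in>A. card {h \<in> M. u a h < u a (g a)})" for g
  define Pr where "Pr g \<longleftrightarrow> config A g \<and> (\<forall>a\<in>A. u a (g0 a) \<le> u a (g a))" for g
  have finA: "finite A" using A by (rule finite_subset) simp
  have "Pr g0" unfolding Pr_def using g0 by simp
  moreover have "\<forall>g. Pr g \<longrightarrow> r g < Suc (card A * card M)"
  proof (intro allI impI)
    fix g
    have "r g \<le> (\<Sum>a\<in>A. card M)" unfolding r_def
      by (intro sum_mono card_mono finite_goods) auto
    then show "r g < Suc (card A * card M)" by simp
  qed
  ultimately have "\<exists>g. Pr g \<and> (\<forall>g'. Pr g' \<longrightarrow> r g' \<le> r g)"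
    by (rule ex_has_greatest_nat)
  then obtain g where g: "Pr g" and mx: "\<And>g'. Pr g' \<Longrightarrow> r g' \<le> r g" by auto
  have "pareto A g"
    unfolding pareto_def
  proof (intro conjI allI impI ballI)
    show "config A g" using g unfolding Pr_def by simp
    fix g' a assume g': "config A g' \<and> (\<forall>a\<in>A. u a (g a) \<le> u a (g' a))" and a: "a \<in> A"
    show "u a (g' a) = u a (g a)"
    proof (rule ccontr)
      assume "u a (g' a) \<noteq> u a (g a)"
      then have lt: "u a (g a) < u a (g' a)" using g' a by force
      have "Pr g'" using g g' unfolding Pr_def by force
      moreover have "r g < r g'" unfolding r_def
      proof (rule sum_strict_mono_ex1[OF finA])
        show "\<forall>b\<in>A. card {h \<in> M. u b h < u b (g b)} \<le> card {h \<in> M. u b h < u b (g' b)}"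
          using g' finite_goods by (fastforce intro!: card_mono)
        have "g a \<in> M" using g a unfolding Pr_def config_def by auto
        then have "{h \<in> M. u a h < u a (g a)} \<subset> {h \<in> M. u a h < u a (g' a)}"
          using lt by force
        then show "\<exists>b\<in>A. card {h \<in> M. u b h < u b (g b)} < card {h \<in> M. u b h < u b (g' b)}"
          using finite_goods a by (intro bexI[of _ a] psubset_card_mono) auto
      qed
      ultimately show False using mx by fastforce
    qed
  qed
  then show thesis using that g unfolding Pr_def by blast
qed

text \<open>Handing \<open>a\<close> a preferred leftover good would be a Pareto
  improvement.\<close>

lemma pareto_leftover:
  assumes "pareto A g" "a \<in> A" "h \<in> M - g ` A"
  shows "u a h \<le> u a (g a)"
proof (rule ccontr)
  assume c: "\<not> u a h \<le> u a (g a)"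
  have "config A (g(a := h))"
    using assms unfolding pareto_def config_def inj_on_def by auto
  moreover have "\<forall>b\<in>A. u b (g b) \<le> u b ((g(a := h)) b)" using c by auto
  ultimately have "u a ((g(a := h)) a) = u a (g a)" using assms unfolding pareto_def by blast
  then show False using c by simp
qed

text \<open>A nonempty set of agents all envying one another contains a closed set on which
  "some agent I envy" is a permutation; trading along it would be a Pareto improvement.\<close>

lemma pareto_envy_free_member:
  assumes g: "pareto A g" and C: "C \<subseteq> A" "C \<noteq> {}" "finite A"
  obtains a where "a \<in> C" "\<And>b. b \<in> C \<Longrightarrow> u a (g b) \<le> u a (g a)"
proof (rule ccontr)
  assume "\<not> thesis"
  then have "\<forall>a\<in>C. \<exists>b\<in>C. u a (g a) < u a (g b)" using that by (meson not_less)
  then obtain p where p: "\<And>a. a \<in> C \<Longrightarrow> p a \<in> C \<and> u a (g a) < u a (g (p a))" by metis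
  define cl where "cl D \<longleftrightarrow> D \<subseteq> C \<and> D \<noteq> {} \<and> p ` D \<subseteq> D" for D
  have "cl C" unfolding cl_def using C p by auto
  then obtain D where D: "cl D" and least: "\<And>D'. cl D' \<Longrightarrow> card D \<le> card D'"
    using ex_has_least_nat[of cl C card] by blast
  have finD: "finite D" using D C unfolding cl_def by (meson finite_subset)
  \<comment> \<open>The image of \<open>D\<close> under \<open>p\<close> is closed too, so
    minimality of \<open>card D\<close> makes \<open>p\<close> injective on
    \<open>D\<close>.\<close>
  have "cl (p ` D)" using D unfolding cl_def by auto
  then have "card D \<le> card (p ` D)" by (rule least)
  then have inj: "inj_on p D"
    using finD card_image_le[OF finD, of p] by (intro eq_card_imp_inj_on) auto
  have DA: "D \<subseteq> A" and pD: "\<And>a. a \<in> D \<Longrightarrow> p a \<in> D" using D C unfolding cl_def by auto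
  define g' where "g' a = (if a \<in> D then g (p a) else g a)" for a
  have gi: "inj_on g A" using g unfolding pareto_def config_def by simp
  have "inj_on g' A"
  proof (rule inj_onI)
    fix a b assume ab: "a \<in> A" "b \<in> A" "g' a = g' b"
    \<comment> \<open>\<open>q c\<close> is the agent whose old good \<open>c\<close> holds after
      the trade.\<close>
    define q where "q c = (if c \<in> D then p c else c)" for c
    have q: "q a \<in> A" "q b \<in> A" "g (q a) = g (q b)"
      using ab DA pD unfolding g'_def q_def by (auto split: if_splits)
    then have "q a = q b" using gi by (meson inj_onD)
    then show "a = b"
      using inj pD unfolding q_def by (auto split: if_splits dest: inj_onD)
  qed
  moreover have "g' ` A \<subseteq> M"
    using g DA pD unfolding g'_def pareto_def config_def by auto
  moreover have DC: "D \<subseteq> C" using D unfolding cl_def by simp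
  have "\<forall>a\<in>A. u a (g a) \<le> u a (g' a)" unfolding g'_def using p DC by force
  ultimately have eq: "\<forall>a\<in>A. u a (g' a) = u a (g a)"
    using g unfolding pareto_def config_def by blast
  obtain a where "a \<in> D" using D unfolding cl_def by auto
  then show False using eq p[of a] DA DC unfolding g'_def by force
qed

section \<open>The goods left over by a bad pair\<close>

lemma card_leftover:
  assumes "s < n" "j < n" "s \<noteq> j" "config ({..<n} - {s,j}) g"
  shows "card (M - g ` ({..<n} - {s,j})) = 4"
proof -
  have "card ({..<n} - {s,j}) = n - 2"
    using assms(1-3) by (subst card_Diff_subset) auto
  then have "card (g ` ({..<n} - {s,j})) = n - 2"
    using assms(4) unfolding config_def by (simp add: card_image)
  moreover have "n \<ge> 2" using assms(1-3) by linarith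
  ultimately show ?thesis
    using assms(4) finite_goods card_goods unfolding config_def
    by (subst card_Diff_subset) auto
qed

lemma obtain_top:
  assumes "L \<subseteq> M" "L \<noteq> {}"
  obtains t where "t \<in> L" "\<And>h. h \<in> L \<Longrightarrow> u i h \<le> u i t"
proof -
  have fin: "finite (u i ` L)" using assms finite_goods by (meson finite_imageI finite_subset)
  then have "Max (u i ` L) \<in> u i ` L" using assms by (intro Max_in) auto
  then obtain t where "t \<in> L" "u i t = Max (u i ` L)" by auto
  then show thesis using that fin by (metis Max_ge imageI)
qed

text \<open>No split of the four leftovers into a pair for \<open>s\<close> and a pair for
  \<open>j\<close> may satisfy both. If their favourites differed, each could get its own; so they
  share a favourite \<open>t\<close>. If one of them liked a pair without \<open>t\<close> at least
  as much as \<open>t\<close>, it could take that pair and leave \<open>t\<close> to the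
  other.\<close>

lemma bad_pair_dominant:
  assumes sj: "s < n" "j < n" "s \<noteq> j" and bad: "bad_pair s j"
    and g: "pareto ({..<n} - {s,j}) g"
  obtains t where "t \<in> M - g ` ({..<n} - {s,j})"
    "dominant s (M - g ` ({..<n} - {s,j})) t" "dominant j (M - g ` ({..<n} - {s,j})) t"
proof -
  define L where "L = M - g ` ({..<n} - {s,j})"
  have conf: "config ({..<n} - {s,j}) g" using g unfolding pareto_def by simp
  have L4: "card L = 4" unfolding L_def using card_leftover[OF sj conf] .
  have LM: "L \<subseteq> M" unfolding L_def by auto
  have finL: "finite L" using LM finite_goods by (rule finite_subset)
  have split: False if P: "P \<subseteq> L" "card P = 2"
    and s: "\<And>h. h \<in> L - P \<Longrightarrow> u s h \<le> v s P" and j: "\<And>h. h \<in> P \<Longrightarrow> u j h \<le> v j (L - P)" for P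
  proof -
    have c2: "card (L - P) = 2" using P L4 finL by (simp add: card_Diff_subset finite_subset)
    have "(\<lambda>i. if i = s then P else if i = j then L - P else if i < n then {g i} else {}) \<in> proper"
    proof (rule two_pairs_proper[OF sj conf])
      show "P \<union> (L - P) = M - g ` ({..<n} - {s,j})" using P unfolding L_def by auto
      show "u i h \<le> u i (g i)" if "i < n" "i \<noteq> s" "i \<noteq> j" "h \<in> P \<union> (L - P)" for i h
        using that P by (intro pareto_leftover[OF g]) (auto simp: L_def)
    qed (use P c2 s j in auto)
    then show False using bad sj P c2 unfolding bad_pair_def by force
  qed
  have ne: "L \<noteq> {}" using L4 by auto
  obtain t where t: "t \<in> L" "\<And>h. h \<in> L \<Longrightarrow> u s h \<le> u s t" using obtain_top[OF LM ne] by blast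
  obtain t' where t': "t' \<in> L" "\<And>h. h \<in> L \<Longrightarrow> u j h \<le> u j t'" using obtain_top[OF LM ne] by blast
  have tt: "t = t'"
  proof (rule ccontr)
    assume ne: "t \<noteq> t'"
    have "card (L - {t,t'}) = 2" using L4 t t' ne finL by simp
    then obtain x where x: "x \<in> L - {t,t'}" by (metis card.empty equals0I zero_neq_numeral)
    show False
    proof (rule split[of "{t,x}"])
      show "card {t,x} = 2" "{t,x} \<subseteq> L" using x t by auto
      show "u s h \<le> v s {t,x}" if "h \<in> L - {t,x}" for h
        using t(2)[of h] u_le_bundle[of s t "{t,x}"] that sj x t LM by force
      show "u j h \<le> v j (L - {t,x})" if "h \<in> {t,x}" for h
      proof -
        have "u j h \<le> u j t'" using that t' t x by blast
        also have "\<dots> \<le> v j (L - {t,x})" using ne t' x LM sj by (intro u_le_bundle) auto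
        finally show ?thesis .
      qed
    qed
  qed
  have compl: "card (L - Q) = 2" "t \<in> L - Q" "Q \<subseteq> L" "L - (L - Q) = Q" "L - Q \<subseteq> M" "L - Q \<subseteq> L"
    if "Q \<subseteq> L - {t}" "card Q = 2" for Q
  proof -
    have "Q \<subseteq> L" using that by auto
    then show "card (L - Q) = 2" using that L4 finL by (simp add: card_Diff_subset finite_subset)
  qed (use that t LM in auto)
  have "dominant j L t" unfolding dominant_def
  proof (intro allI impI)
    fix Q assume Q: "Q \<subseteq> L - {t} \<and> card Q = 2"
    note c = compl[OF conjunct1[OF Q] conjunct2[OF Q]]
    show "v j Q < u j t"
    proof (rule ccontr)
      assume nl: "\<not> v j Q < u j t"
      show False
      proof (rule split[of "L - Q"])
        show "u s h \<le> v s (L - Q)" if "h \<in> L - (L - Q)" for h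
          using t(2)[of h] u_le_bundle[OF sj(1) c(2) c(5)] that by force
        show "u j h \<le> v j (L - (L - Q))" if "h \<in> L - Q" for h
          using t'(2)[of h] nl that unfolding c(4) tt by force
      qed (use c in auto)
    qed
  qed
  moreover have "dominant s L t" unfolding dominant_def
  proof (intro allI impI)
    fix Q assume Q: "Q \<subseteq> L - {t} \<and> card Q = 2"
    note c = compl[OF conjunct1[OF Q] conjunct2[OF Q]]
    show "v s Q < u s t"
    proof (rule ccontr)
      assume nl: "\<not> v s Q < u s t"
      show False
      proof (rule split[of Q])
        show "u s h \<le> v s Q" if "h \<in> L - Q" for h
          using t(2)[of h] nl that by force
        show "u j h \<le> v j (L - Q)" if "h \<in> Q" for h
          using t'(2)[of h] u_le_bundle[OF sj(2) c(2) c(5)] that c(3) tt by force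
      qed (use Q c in auto)
    qed
  qed
  ultimately show thesis using that t(1) unfolding L_def by blast
qed

end

subsection \<open>Two agents who cannot both receive pairs\<close>

text \<open>One stage of the descent for a fixed \<open>s\<close>: \<open>j\<close>,
  \<open>g\<close> and \<open>t\<close> vary from stage to stage, and \<open>u s t\<close>
  decreases. A bad pair is recorded only through the dominant good \<open>t\<close> it
  yields.\<close>

locale blocked = strict_instance n M v
  for n :: nat and M :: "'g set" and v :: "nat \<Rightarrow> 'g set \<Rightarrow> real" +
  fixes s j :: nat and g :: "nat \<Rightarrow> 'g" and t :: 'g
  assumes s: "s < n" and j: "j < n" and s_neq_j: "s \<noteq> j"
    and pareto_g: "pareto ({..<n} - {s,j}) g"
    and t_leftover: "t \<in> M - g ` ({..<n} - {s,j})"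
    and dominant_s: "dominant s (M - g ` ({..<n} - {s,j})) t"
    and dominant_j: "dominant j (M - g ` ({..<n} - {s,j})) t"
begin

definition A :: "nat set" where "A = {..<n} - {s,j}"

definition R :: "'g set" where "R = M - g ` A - {t}"

lemma A_less: "a \<in> A \<Longrightarrow> a < n \<and> a \<noteq> s \<and> a \<noteq> j"
  unfolding A_def by auto

lemma not_in_A: "s \<notin> A" "j \<notin> A"
  unfolding A_def by auto

lemma agents_eq: "{..<n} = insert s (insert j A)"
  unfolding A_def using s j by auto

lemma finite_A: "finite A"
  unfolding A_def by simp

lemma inj_g: "inj_on g A" and g_in: "a \<in> A \<Longrightarrow> g a \<in> M"
  using pareto_g unfolding pareto_def config_def A_def by auto

lemma t_in: "t \<in> M" and t_notin_g: "t \<notin> g ` A" and t_notin_R: "t \<notin> R"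
  using t_leftover unfolding R_def A_def by auto

lemma R_subset: "R \<subseteq> M" and g_notin_R: "a \<in> A \<Longrightarrow> g a \<notin> R"
  unfolding R_def by auto

lemma finite_R: "finite R"
  using R_subset finite_goods by (rule finite_subset)

lemma card_R: "card R = 3"
proof -
  have "card (M - g ` A) = 4"
    unfolding A_def using pareto_g unfolding pareto_def by (intro card_leftover s j s_neq_j) auto
  then show ?thesis unfolding R_def using t_leftover finite_goods by (simp add: A_def)
qed

lemma unenvied:
  assumes "a \<in> A" "h = t \<or> h \<in> R"
  shows "u a h \<le> u a (g a)"
  using pareto_leftover[OF pareto_g] assms t_leftover unfolding R_def A_def by blast

lemma pair_less_t:
  assumes "T \<subseteq> R" "card T = 2"
  shows "v s T < u s t" "v j T < u j t"
  using dominant_s dominant_j assms unfolding dominant_def R_def A_def by auto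

lemma obtain_pair:
  assumes "h \<in> R"
  obtains T where "T \<subseteq> R" "card T = 2" "h \<in> T"
proof -
  have "card (R - {h}) = 2" using assms card_R by simp
  then obtain k where "k \<in> R - {h}" by (metis card.empty equals0I zero_neq_numeral)
  then show thesis using that[of "{h,k}"] assms by auto
qed

lemma single_less_t:
  assumes "h \<in> R"
  shows "u s h < u s t" "u j h < u j t"
proof -
  obtain T where T: "T \<subseteq> R" "card T = 2" "h \<in> T" using obtain_pair[OF assms] .
  have "T \<subseteq> M" using T R_subset by auto
  then show "u s h < u s t" "u j h < u j t"
    using pair_less_t[OF T(1,2)] u_le_bundle[OF s T(3)] u_le_bundle[OF j T(3)] by force+
qed

text \<open>Agent \<open>j\<close> takes \<open>t\<close>, which it prefers to every pair in
  \<open>R\<close> by dominance, and \<open>s\<close> takes \<open>R\<close>.\<close>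

lemma triple_without_envy:
  assumes "\<And>a T. a \<in> A \<Longrightarrow> T \<subseteq> R \<Longrightarrow> card T = 2 \<Longrightarrow> v a T \<le> u a (g a)"
  obtains Z where "Z \<in> proper" "card (Z s) = 3"
proof -
  have eq: "{..<n} - {s} = insert j A" using agents_eq not_in_A s_neq_j by auto
  have im: "(g(j := t)) ` ({..<n} - {s}) = insert t (g ` A)"
    unfolding eq using not_in_A by auto
  have conf: "config ({..<n} - {s}) (g(j := t))"
    unfolding config_def im unfolding eq using inj_g g_in t_in t_notin_g not_in_A
    by (auto simp: inj_on_def)
  have R: "R = M - (g(j := t)) ` ({..<n} - {s})"
    unfolding im R_def by auto
  have "v i T \<le> u i ((g(j := t)) i)" if "i < n" "i \<noteq> s" "T \<subseteq> R" "card T = 2" for i T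
    using that assms[of i T] pair_less_t[of T] unfolding A_def by auto
  from triple_proper[OF s conf R this] show thesis using that card_R by fastforce
qed

text \<open>Agent \<open>k\<close> takes the place of \<open>j\<close>: \<open>j\<close> receives
  \<open>t\<close>, the good of \<open>k\<close> is released, and the assignment is improved to a
  Pareto optimal \<open>g'\<close>. The new dominant good \<open>t'\<close> turns out to lie in
  \<open>T\<close>, hence in \<open>R\<close>, where \<open>s\<close> values everything below
  \<open>t\<close>.\<close>

lemma descend:
  assumes k: "k \<in> A" and T: "T \<subseteq> R" "card T = 2" "u k (g k) < v k T" and bad_k: "bad_pair s k"
  obtains g' t' where "blocked n M v s k g' t'" "u s t' < u s t"
proof -
  have kn: "k < n" "k \<noteq> s" "k \<noteq> j" using A_less[OF k] by auto
  define A' where "A' = {..<n} - {s,k}"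
  have A': "A' = insert j (A - {k})" unfolding A'_def agents_eq using not_in_A kn s_neq_j by auto
  have conf0: "config A' (g(j := t))"
    unfolding config_def A' using inj_g g_in t_in t_notin_g not_in_A
    by (auto simp: inj_on_def)
  obtain g' where g': "pareto A' g'" "\<And>a. a \<in> A' \<Longrightarrow> u a ((g(j := t)) a) \<le> u a (g' a)"
    using pareto_exists[OF conf0] unfolding A'_def by blast
  have conf': "inj_on g' A'" "g' ` A' \<subseteq> M" using g'(1) unfolding pareto_def config_def by auto
  have gA: "u a (g a) \<le> u a (g' a)" if "a \<in> A - {k}" for a
    using g'(2)[of a] that A' not_in_A by (cases "a = j") auto
  have gj: "u j t \<le> u j (g' j)" using g'(2)[of j] A' by auto
  define L' where "L' = M - g' ` A'"
  \<comment> \<open>Every agent of \<open>A'\<close> holds under \<open>g'\<close> a good strictly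
    better for it than any good of \<open>R\<close>, so \<open>R\<close> stays untouched. For agents
    of \<open>A\<close> strictness comes from the absence of ties.\<close>
  have RL: "R \<subseteq> L'"
  proof
    fix r assume r: "r \<in> R"
    have "r \<noteq> g' a" if a: "a \<in> A'" for a
    proof (cases "a = j")
      case True
      then show ?thesis using gj single_less_t(2)[OF r] by auto
    next
      case False
      then have a': "a \<in> A - {k}" using a A' by auto
      have "u a r \<le> u a (g a)" using unenvied a' r by auto
      moreover have "r \<noteq> g a" using g_notin_R a' r by auto
      then have "u a r \<noteq> u a (g a)"
        using u_eq_imp_eq[of a r "g a"] A_less a' r R_subset g_in by auto
      ultimately show ?thesis using gA[OF a'] by auto
    qed
    then show "r \<in> L'" unfolding L'_def using r R_subset by auto
  qed
  obtain t' where t': "t' \<in> L'" "dominant s L' t'" "dominant k L' t'"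
    using bad_pair_dominant[OF s kn(1) _ bad_k, of g'] g'(1) kn unfolding L'_def A'_def by metis
  \<comment> \<open>If \<open>k\<close> preferred a new leftover \<open>d\<close>, then giving
    \<open>d\<close> to \<open>k\<close> and the goods of \<open>g'\<close> to the rest of
    \<open>A\<close> would improve on \<open>g\<close>.\<close>
  have le: "u k d \<le> u k (g k)" if d: "d \<in> L'" for d
  proof (rule ccontr)
    assume nl: "\<not> u k d \<le> u k (g k)"
    define f where "f = g'(k := d)"
    have "config ({..<n} - {s,j}) f"
    proof -
      have "inj_on f A"
      proof (rule inj_onI)
        fix a b assume ab: "a \<in> A" "b \<in> A" "f a = f b"
        show "a = b"
        proof (cases "a = k \<or> b = k")
          case True
          have "d \<noteq> g' c" if "c \<in> A - {k}" for c using d that unfolding L'_def A' by auto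
          then show ?thesis using True ab unfolding f_def by (metis Diff_iff empty_iff fun_upd_apply insert_iff)
        next
          case False
          then have "a \<in> A'" "b \<in> A'" "g' a = g' b" using ab A' unfolding f_def by auto
          then show ?thesis using conf'(1) by (meson inj_onD)
        qed
      qed
      moreover have "f ` A \<subseteq> M"
        using conf'(2) d unfolding f_def A' L'_def by auto
      ultimately show ?thesis unfolding config_def A_def by simp
    qed
    moreover have "u a (g a) \<le> u a (f a)" if "a \<in> {..<n} - {s,j}" for a
      using gA[of a] that nl unfolding f_def A_def by auto
    ultimately have "u k (f k) = u k (g k)"
      using pareto_g k unfolding pareto_def A_def by blast
    then show False using nl unfolding f_def by simp
  qed
  \<comment> \<open>Otherwise dominance of \<open>t'\<close> for \<open>k\<close> yields
    \<open>v k T < u k t'\<close>, while \<open>u k t'\<close> is at most \<open>u k (g k)\<close>,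
    which is less than \<open>v k T\<close>.\<close>
  have "t' \<in> T"
  proof (rule ccontr)
    assume "t' \<notin> T"
    then have "T \<subseteq> L' - {t'}" using T RL by auto
    then have "v k T < u k t'" using t'(3) T unfolding dominant_def by blast
    then show False using le[OF t'(1)] T(3) by linarith
  qed
  then have "u s t' < u s t" using single_less_t(1) T by blast
  moreover have "blocked n M v s k g' t'"
    using s kn g'(1) t' unfolding A'_def L'_def
    by unfold_locales auto
  ultimately show thesis using that by blast
qed

section \<open>Pairs for \<open>s\<close> obtained from a source\<close>

text \<open>Here \<open>s\<close> counts as envying \<open>a\<close> only if it prefers \<open>g a\<close> to every pair in \<open>R\<close>.\<close>

definition source :: "nat \<Rightarrow> bool" where
  "source a \<longleftrightarrow> a \<in> A \<and> (\<forall>i\<in>A. u i (g a) \<le> u i (g i)) \<and> u j (g a) \<le> u j t \<and>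
     (\<exists>P. P \<subseteq> R \<and> card P = 2 \<and> u s (g a) \<le> v s P)"

text \<open>The other agents hold one good each, \<open>j\<close> holding \<open>t\<close>. None of
  them envies \<open>g a\<close>, as \<open>a\<close> is a source, nor a good of \<open>R\<close>,
  by Pareto optimality or dominance of \<open>t\<close>. So only \<open>s\<close> and
  \<open>a\<close> impose conditions.\<close>

lemma split_with_source:
  assumes a: "source a" and PQ: "P \<union> Q = insert (g a) R" "P \<inter> Q = {}" "card P = 2" "card Q = 2"
    and P: "\<And>h. h \<in> Q \<Longrightarrow> u s h \<le> v s P" and Q: "\<And>h. h \<in> P \<Longrightarrow> u a h \<le> v a Q"
  obtains X where "X \<in> proper" "X s = P" "X a = Q"
proof -
  have aA: "a \<in> A" and an: "a < n" "a \<noteq> s" "a \<noteq> j" using a A_less unfolding source_def by auto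
  have eq: "{..<n} - {s,a} = insert j (A - {a})" unfolding agents_eq using not_in_A an s_neq_j by auto
  have im: "(g(j := t)) ` ({..<n} - {s,a}) = insert t (g ` (A - {a}))"
    unfolding eq using not_in_A by auto
  have conf: "config ({..<n} - {s,a}) (g(j := t))"
    unfolding config_def im unfolding eq using inj_g g_in t_in t_notin_g not_in_A
    by (auto simp: inj_on_def)
  have "g ` (A - {a}) = g ` A - {g a}" using inj_g aA by (auto simp: inj_on_def)
  then have rest: "P \<union> Q = M - (g(j := t)) ` ({..<n} - {s,a})"
    unfolding im PQ(1) R_def using g_in[OF aA] aA t_notin_g by auto
  have "(\<lambda>i. if i = s then P else if i = a then Q else if i < n then {(g(j := t)) i} else {}) \<in> proper"
  proof (rule two_pairs_proper[OF s an(1) _ conf rest PQ(2-4) _ P Q])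
    fix i h assume i: "i < n" "i \<noteq> s" "i \<noteq> a" and h: "h \<in> P \<union> Q"
    then have h': "h = g a \<or> h \<in> R" using PQ(1) by auto
    show "u i h \<le> u i ((g(j := t)) i)"
    proof (cases "i = j")
      case True
      then show ?thesis using h' a single_less_t(2)[of h] unfolding source_def by auto
    next
      case False
      then have "i \<in> A" using i unfolding A_def by auto
      then show ?thesis using False h' a unenvied[of i h] unfolding source_def by auto
    qed
  qed (use an in auto)
  then show thesis using that an by fastforce
qed

text \<open>Agent \<open>s\<close> takes its best pair in \<open>R\<close>, and \<open>a\<close>
  keeps \<open>g a\<close> together with the remaining good \<open>r\<close>. The best pair is worth
  at least \<open>r\<close>, because \<open>r\<close> itself lies in some pair of
  \<open>R\<close>.\<close>

lemma source_pair:
  assumes a: "source a"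
  obtains X where "X \<in> proper" "X s \<subseteq> R" "card (X s) = 2" "card (X a) = 2"
proof -
  have aA: "a \<in> A" and an: "a < n" "a \<noteq> s" "a \<noteq> j" using a A_less unfolding source_def by auto
  obtain P0 where P0: "P0 \<subseteq> R" "card P0 = 2" "u s (g a) \<le> v s P0" using a unfolding source_def by auto
  define \<P> where "\<P> = {P. P \<subseteq> R \<and> card P = 2}"
  have fin: "finite \<P>" unfolding \<P>_def using finite_R by simp
  have "P0 \<in> \<P>" unfolding \<P>_def using P0 by simp
  then have "Max (v s ` \<P>) \<in> v s ` \<P>" using fin by (intro Max_in) auto
  then obtain P where P: "P \<in> \<P>" "v s P = Max (v s ` \<P>)" by auto
  have best: "v s P' \<le> v s P" if "P' \<in> \<P>" for P' using P fin that by simp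
  have PR: "P \<subseteq> R" "card P = 2" using P unfolding \<P>_def by auto
  have "card (R - P) = 1" using PR card_R finite_R by (simp add: card_Diff_subset finite_subset)
  then obtain r where r: "R - P = {r}" by (meson card_1_singletonE)
  have rR: "r \<in> R" "r \<notin> P" using r by auto
  obtain X where "X \<in> proper" "X s = P" "X a = {g a, r}"
  proof (rule split_with_source[OF a])
    show "P \<union> {g a, r} = insert (g a) R" using r PR by auto
    show "P \<inter> {g a, r} = {}" using rR PR g_notin_R[OF aA] by auto
    show "card P = 2" "card {g a, r} = 2" using PR rR g_notin_R[OF aA] by (auto simp: card_2_iff)
    show "u s h \<le> v s P" if "h \<in> {g a, r}" for h
    proof (cases "h = r")
      case True
      obtain T where T: "T \<subseteq> R" "card T = 2" "r \<in> T" using obtain_pair[OF rR(1)] .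
      then have "u s r \<le> v s T" using R_subset s by (intro u_le_bundle) auto
      also have "\<dots> \<le> v s P" using best T unfolding \<P>_def by auto
      finally show ?thesis using True by simp
    next
      case False
      then show ?thesis using that P0 best[OF \<open>P0 \<in> \<P>\<close>] by auto
    qed
    show "u a h \<le> v a {g a, r}" if "h \<in> P" for h
    proof -
      have "u a h \<le> u a (g a)" using unenvied[OF aA] that PR by auto
      also have "\<dots> \<le> v a {g a, r}" using an g_in[OF aA] rR R_subset by (intro u_le_bundle) auto
      finally show ?thesis .
    qed
  qed
  moreover have "card {g a, r} = 2" using rR g_notin_R[OF aA] by (auto simp: card_2_iff)
  ultimately show thesis using that PR by auto
qed

text \<open>Two different pairs for \<open>s\<close> are produced. If \<open>s\<close> likes
  \<open>g k\<close> at least as much as its favourite \<open>x\<close> in \<open>R\<close>, one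
  pair lies in \<open>R\<close> and the other contains \<open>g k\<close>, with \<open>k\<close>
  taking \<open>T\<close>. Otherwise \<open>x\<close> can be joined with either of the other two
  goods of \<open>R\<close>.\<close>

lemma envious_source:
  assumes k: "source k" and T: "T \<subseteq> R" "card T = 2" "u k (g k) < v k T"
  shows "surplus s \<ge> 2"
proof -
  have kA: "k \<in> A" and kn: "k < n" "k \<noteq> s" "k \<noteq> j" using k A_less unfolding source_def by auto
  have gk: "g k \<notin> R" "g k \<in> M" using g_notin_R g_in kA by auto
  obtain x where x: "x \<in> R" "\<And>h. h \<in> R \<Longrightarrow> u s h \<le> u s x"
    using obtain_top[OF R_subset] card_R by (metis card.empty zero_neq_numeral)
  show ?thesis
  proof (cases "u s x \<le> u s (g k)")
    case True
    obtain X where X: "X \<in> proper" "X s \<subseteq> R" "card (X s) = 2" using source_pair[OF k] by blast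
    have "card (R - T) = 1" using T card_R finite_R by (simp add: card_Diff_subset finite_subset)
    then obtain r where r: "R - T = {r}" by (meson card_1_singletonE)
    have rR: "r \<in> R" "r \<notin> T" using r by auto
    obtain Y where Y: "Y \<in> proper" "Y s = {g k, r}"
    proof (rule split_with_source[OF k, of "{g k, r}" T])
      show "{g k, r} \<union> T = insert (g k) R" using r T by auto
      show "{g k, r} \<inter> T = {}" using rR T gk by auto
      show "card T = 2" "card {g k, r} = 2" using T rR gk by (auto simp: card_2_iff)
      show "u s h \<le> v s {g k, r}" if "h \<in> T" for h
      proof -
        have "u s h \<le> u s (g k)" using x(2)[of h] True that T by auto
        also have "\<dots> \<le> v s {g k, r}" using s gk rR R_subset by (intro u_le_bundle) auto
        finally show ?thesis .
      qed
      show "u k h \<le> v k T" if "h \<in> {g k, r}" for h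
        using that T(3) unenvied[OF kA, of r] rR by auto
    qed
    have "X \<noteq> Y" using X Y gk by auto
    moreover have "card (Y s) = 2" using Y rR gk by (auto simp: card_2_iff)
    ultimately show ?thesis using surplus_ge_two_pairs[OF X(1) Y(1)] X by auto
  next
    case False
    have *: "\<exists>X\<in>proper. X s = {x,y}" if y: "y \<in> R" "z \<in> R" "R = {x,y,z}" "x \<noteq> y" "x \<noteq> z" "y \<noteq> z" for y z
    proof (rule split_with_source[OF k, of "{x,y}" "{g k, z}"])
      show "{x,y} \<union> {g k, z} = insert (g k) R" using y by auto
      show "{x,y} \<inter> {g k, z} = {}" using x y gk by auto
      show "card {x,y} = 2" "card {g k, z} = 2" using y gk by (auto simp: card_2_iff)
      show "u s h \<le> v s {x,y}" if "h \<in> {g k, z}" for h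
      proof -
        have "u s h \<le> u s x" using False x(2)[of z] that y by auto
        also have "\<dots> \<le> v s {x,y}" using s x y R_subset by (intro u_le_bundle) auto
        finally show ?thesis .
      qed
      show "u k h \<le> v k {g k, z}" if "h \<in> {x,y}" for h
      proof -
        have "u k h \<le> u k (g k)" using unenvied[OF kA] that x y by auto
        also have "\<dots> \<le> v k {g k, z}" using kn gk y R_subset by (intro u_le_bundle) auto
        finally show ?thesis .
      qed
    qed blast
    have "card (R - {x}) = 2" using x card_R by simp
    then obtain y z where yz: "R - {x} = {y,z}" "y \<noteq> z" by (meson card_2_iff)
    then have d: "R = {x,y,z}" "x \<noteq> y" "x \<noteq> z" using x by auto
    obtain X Y where "X \<in> proper" "X s = {x,y}" "Y \<in> proper" "Y s = {x,z}"
      using *[of y z] *[of z y] d yz by blast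
    moreover have "{x,y} \<noteq> {x,z}" using yz by (auto simp: doubleton_eq_iff)
    ultimately show ?thesis using surplus_ge_two_pairs[of X Y s] d by force
  qed
qed

section \<open>Shifting goods along envy paths\<close>

definition envy :: "(nat \<times> nat) set" where
  "envy = {(b, c). b \<in> A \<and> c \<in> A \<and> u b (g b) < u b (g c)}"

text \<open>By Pareto optimality every nonempty set of assigned agents has a member envying nobody
  in the set, which is well-foundedness of the converse.\<close>

lemma acyclic_envy: "acyclic envy"
proof -
  have "\<exists>z\<in>Q. \<forall>y. (y, z) \<in> envy\<inverse> \<longrightarrow> y \<notin> Q" if "x \<in> Q" for x Q
  proof (cases "Q \<inter> A = {}")
    case True
    then show ?thesis using that unfolding envy_def by auto
  next
    case False
    obtain z where "z \<in> Q \<inter> A" "\<And>b. b \<in> Q \<inter> A \<Longrightarrow> u z (g b) \<le> u z (g z)"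
      using pareto_envy_free_member[of A g "Q \<inter> A"] pareto_g False finite_A unfolding A_def by blast
    then show ?thesis unfolding envy_def by (intro bexI[of _ z]) force+
  qed
  then have "wf (envy\<inverse>)" unfolding wf_eq_minimal by blast
  then show ?thesis using wf_acyclic acyclic_converse by blast
qed

lemma wf_envy: "wf envy"
proof (rule finite_acyclic_wf[OF _ acyclic_envy])
  show "finite envy" by (rule finite_subset[of _ "A \<times> A"]) (auto simp: envy_def finite_A)
qed

text \<open>The assignment left after goods have been shifted along an envy path from \<open>s\<close> to \<open>k\<close>. The last
  clause, together with acyclicity of envy, guarantees that \<open>k\<close> still holds \<open>g k\<close> when the path is
  extended.\<close>

definition frees :: "nat \<Rightarrow> (nat \<Rightarrow> 'g) \<Rightarrow> bool" where
  "frees k f \<longleftrightarrow> inj_on f ({..<n} - {k}) \<and> f ` ({..<n} - {k}) = insert t (g ` A) \<and>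
     (\<forall>i\<in>A - {k}. u i (g i) \<le> u i (f i)) \<and> u j t \<le> u j (f j) \<and>
     (\<forall>P. P \<subseteq> R \<and> card P = 2 \<longrightarrow> v s P \<le> u s (f s)) \<and>
     (\<forall>c\<in>A - {k}. (c, k) \<notin> envy\<^sup>+ \<longrightarrow> f c = g c)"

text \<open>As \<open>k\<close> is no source, its good is wanted by \<open>s\<close>, by
  \<open>j\<close> or by some \<open>b\<close> in \<open>A\<close>. In the first two cases that
  agent takes \<open>g k\<close> and the other one of \<open>s\<close> and \<open>j\<close> takes
  \<open>t\<close>; in the third, \<open>b\<close> is freed by induction and takes
  \<open>g k\<close>.\<close>

lemma frees_exists:
  assumes nosource: "\<And>a. \<not> source a"
  shows "k \<in> A \<Longrightarrow> \<exists>f. frees k f"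
proof (induction k rule: wf_induct_rule[OF wf_envy])
  case (1 k)
  have kA: "k \<in> A" and kn: "k < n" "k \<noteq> s" "k \<noteq> j" using 1 A_less by auto
  have eq: "{..<n} - {k} = insert s (insert j (A - {k}))"
    unfolding agents_eq using kn by auto
  have gkt: "g k \<noteq> t" using t_notin_g kA by auto
  have gk: "g k \<notin> g ` (A - {k})" using inj_g kA by (auto simp: inj_on_def)
  have im: "g ` A = insert (g k) (g ` (A - {k}))" using kA by auto
  \<comment> \<open>Both base cases hand \<open>t\<close> and \<open>g k\<close> to \<open>j\<close>
    and \<open>s\<close> in one order or the other, so injectivity and image are checked once for
    both.\<close>
  have upd: "inj_on (g(j := x, s := y)) ({..<n} - {k})"
    "(g(j := x, s := y)) ` ({..<n} - {k}) = insert t (g ` A)"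
    if xy: "x = t \<and> y = g k \<or> x = g k \<and> y = t" for x y
  proof -
    let ?f = "g(j := x, s := y)"
    have same: "?f a = g a" if "a \<in> A - {k}" for a using that not_in_A by auto
    then have imf: "?f ` (A - {k}) = g ` (A - {k})" by (rule image_cong[OF refl])
    have "inj_on g (A - {k})" using inj_g by (rule inj_on_subset) auto
    then have injf: "inj_on ?f (A - {k})" using inj_on_cong[of "A - {k}" ?f g] same by blast
    have "t \<notin> g ` (A - {k})" using t_notin_g by auto
    then have new: "x \<notin> g ` (A - {k})" "y \<notin> g ` (A - {k})" "x \<noteq> y"
      using xy gk gkt by metis+
    have fs: "?f s = y" "?f j = x" using s_neq_j by auto
    have out: "A - {k} - {s} = A - {k}" "A - {k} - {j} = A - {k}" using not_in_A by auto
    show "inj_on ?f ({..<n} - {k})"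
      unfolding eq inj_on_insert using injf imf new fs out s_neq_j
      by (simp add: insert_Diff_if del: fun_upd_apply)
    show "?f ` ({..<n} - {k}) = insert t (g ` A)"
      unfolding eq im image_insert imf fs using xy by auto
  qed
  consider (from_s) "\<forall>P. P \<subseteq> R \<and> card P = 2 \<longrightarrow> v s P < u s (g k)"
    | (from_j) "u j t < u j (g k)" | (from_A) b where "(b, k) \<in> envy"
    using nosource[of k] kA unfolding source_def envy_def by (force simp: not_le)
  then show ?case
  proof cases
    case from_s
    have "frees k (g(j := t, s := g k))"
      unfolding frees_def using upd[of t "g k"] not_in_A s_neq_j from_s by (auto simp: less_imp_le)
    then show ?thesis by blast
  next
    case from_j
    have "frees k (g(j := g k, s := t))"
      unfolding frees_def using upd[of "g k" t] not_in_A s_neq_j from_j pair_less_t(1)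
      by (auto simp: less_imp_le)
    then show ?thesis by blast
  next
    case (from_A b)
    have bA: "b \<in> A" and ub: "u b (g b) < u b (g k)" and bk: "b \<noteq> k"
      using from_A unfolding envy_def by auto
    have bn: "b < n" "b \<noteq> s" "b \<noteq> j" using A_less bA by auto
    obtain f where f: "frees b f" using 1(1)[OF from_A bA] by blast
    have "(k, b) \<notin> envy\<^sup>+"
      using from_A acyclic_envy unfolding acyclic_def by (meson r_into_trancl' trancl_trans)
    then have fk: "f k = g k" using f kA bk unfolding frees_def by auto
    \<comment> \<open>\<open>b\<close> needs no good under \<open>f\<close>, and \<open>k\<close>
      gives up \<open>g k\<close>, so the set of goods in use does not change.\<close>
    define f' where "f' = f(b := g k)"
    have "inj_on f' ({..<n} - {k})"
    proof (rule inj_onI)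
      fix x y assume xy: "x \<in> {..<n} - {k}" "y \<in> {..<n} - {k}" "f' x = f' y"
      define q where "q c = (if c = b then k else c)" for c
      have "f (q x) = f (q y)" "q x \<in> {..<n} - {b}" "q y \<in> {..<n} - {b}"
        using xy fk kn bk unfolding f'_def q_def by (auto split: if_splits)
      then have "q x = q y" using f unfolding frees_def by (meson inj_onD)
      then show "x = y" using xy unfolding q_def by (auto split: if_splits)
    qed
    moreover have "f' ` ({..<n} - {k}) = f ` ({..<n} - {b})"
    proof -
      have "{..<n} - {k} = insert b ({..<n} - {b,k})" "{..<n} - {b} = insert k ({..<n} - {b,k})"
        using bn kn bk by auto
      moreover have "f' ` ({..<n} - {b,k}) = f ` ({..<n} - {b,k})" unfolding f'_def by auto
      moreover have "f' b = f k" unfolding f'_def using fk by simp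
      ultimately show ?thesis by (simp only: image_insert)
    qed
    moreover have "f' c = g c" if c: "c \<in> A - {k}" "(c, k) \<notin> envy\<^sup>+" for c
    proof -
      have "c \<noteq> b" "(c, b) \<notin> envy\<^sup>+" using c from_A by (auto intro: trancl_into_trancl)
      then show ?thesis using f c unfolding frees_def f'_def by auto
    qed
    ultimately have "frees k f'"
      using f ub bn unfolding frees_def f'_def by auto
    then show ?thesis by blast
  qed
qed

text \<open>Without descent, each envious agent shares pairs with \<open>s\<close>, and low surplus
  leaves only one such \<open>k\<close>. A source would share pairs with \<open>s\<close> too, so it
  would be \<open>k\<close> and give \<open>s\<close> surplus 2. Hence there is no source, and
  \<open>k\<close> can be freed to take \<open>R\<close>.\<close>

lemma partner_or_descend:
  assumes low: "surplus s \<le> 1"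
  shows "(\<exists>k Y Z. k < n \<and> k \<noteq> s \<and> Y \<in> proper \<and> card (Y s) = 2 \<and> card (Y k) = 2 \<and>
             Z \<in> proper \<and> card (Z k) = 3) \<or>
         (\<exists>k g' t'. blocked n M v s k g' t' \<and> u s t' < u s t)"
proof (rule disjCI)
  assume nodesc: "\<nexists>k g' t'. blocked n M v s k g' t' \<and> u s t' < u s t"
  define envious where
    "envious k \<longleftrightarrow> k \<in> A \<and> (\<exists>T. T \<subseteq> R \<and> card T = 2 \<and> u k (g k) < v k T)" for k
  have edge: "\<exists>Y\<in>proper. card (Y s) = 2 \<and> card (Y k) = 2" if k: "envious k" for k
  proof (rule ccontr)
    assume "\<not> ?thesis"
    then have "bad_pair s k" unfolding bad_pair_def by blast
    then show False using k descend nodesc unfolding envious_def by metis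
  qed
  have "\<exists>k. envious k"
  proof (rule ccontr)
    assume "\<not> ?thesis"
    then obtain Z where "Z \<in> proper" "card (Z s) = 3"
      using triple_without_envy unfolding envious_def by (metis not_le)
    then show False using surplus_ge_triple low by fastforce
  qed
  then obtain k where k: "envious k" by blast
  then have kA: "k \<in> A" unfolding envious_def by simp
  then have kn: "k < n" "k \<noteq> s" "k \<noteq> j" using A_less by auto
  obtain Y where Y: "Y \<in> proper" "card (Y s) = 2" "card (Y k) = 2" using edge[OF k] by blast
  have partner: "a = k" if "a < n" "a \<noteq> s" "X \<in> proper" "card (X s) = 2" "card (X a) = 2" for a X
    using surplus_ge_two_partners[of X Y s a k] that Y kn s low by fastforce
  have only: "a = k" if "envious a" for a
    using edge[OF that] partner A_less that unfolding envious_def by blast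
  have "\<not> source a" for a
  proof
    assume a: "source a"
    then have aA: "a \<in> A" unfolding source_def by simp
    have "a = k" using source_pair[OF a] partner A_less[OF aA] by metis
    then show False using envious_source a k low unfolding envious_def by fastforce
  qed
  then obtain f where f: "frees k f" using frees_exists kA by blast
  have conf: "config ({..<n} - {k}) f"
    using f g_in t_in unfolding frees_def config_def by auto
  have R: "R = M - f ` ({..<n} - {k})" using f unfolding frees_def R_def by auto
  have "v i T \<le> u i (f i)" if i: "i < n" "i \<noteq> k" and T: "T \<subseteq> R" "card T = 2" for i T
  proof -
    consider "i = s" | "i = j" | "i \<in> A" using i unfolding A_def by auto
    then show ?thesis
    proof cases
      case 1
      then show ?thesis using f T unfolding frees_def by auto
    next
      case 2
      then show ?thesis using f pair_less_t(2)[OF T] unfolding frees_def by auto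
    next
      case 3
      then have "v i T \<le> u i (g i)" using only[of i] T i unfolding envious_def by force
      moreover have "u i (g i) \<le> u i (f i)" using f 3 i unfolding frees_def by blast
      ultimately show ?thesis by linarith
    qed
  qed
  from triple_proper[OF kn(1) conf R this]
  obtain Z where "Z \<in> proper" "card (Z k) = 3" using card_R by fastforce
  then show "\<exists>k Y Z. k < n \<and> k \<noteq> s \<and> Y \<in> proper \<and> card (Y s) = 2 \<and> card (Y k) = 2 \<and>
             Z \<in> proper \<and> card (Z k) = 3" using kn Y by blast
qed

end

subsection \<open>Counting\<close>

context strict_instance
begin

text \<open>Some \<open>j\<close> forms a bad pair with \<open>s\<close>: otherwise two further
  agents, available since \<open>n\<close> is at least 3, would both share pairs with
  \<open>s\<close>. A stage minimizing \<open>u s t\<close> then rules out further descent.\<close>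

lemma deficient_partner:
  assumes s: "s < n" and n: "n \<ge> 3" and low: "surplus s \<le> 1"
  shows "\<exists>k Y Z. k < n \<and> k \<noteq> s \<and> Y \<in> proper \<and> card (Y s) = 2 \<and> card (Y k) = 2 \<and>
             Z \<in> proper \<and> card (Z k) = 3"
proof -
  have "\<exists>j<n. j \<noteq> s \<and> bad_pair s j"
  proof (rule ccontr)
    assume c: "\<not> ?thesis"
    have "\<exists>a b. a < n \<and> b < n \<and> a \<noteq> s \<and> b \<noteq> s \<and> a \<noteq> b"
    proof -
      have "card ({..<n} - {s}) \<ge> 2" using s n by simp
      then obtain B where B: "B \<subseteq> {..<n} - {s}" "card B = 2" by (meson obtain_subset_with_card_n)
      then obtain a b where "B = {a,b}" "a \<noteq> b" by (meson card_2_iff)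
      then show ?thesis using B(1) by auto
    qed
    then obtain a b where ab: "a < n" "b < n" "a \<noteq> s" "b \<noteq> s" "a \<noteq> b" by blast
    obtain X where X: "X \<in> proper" "card (X s) = 2" "card (X a) = 2"
      using c ab unfolding bad_pair_def by blast
    obtain Y where Y: "Y \<in> proper" "card (Y s) = 2" "card (Y b) = 2"
      using c ab unfolding bad_pair_def by blast
    show False using surplus_ge_two_partners[of X Y s a b] X Y ab s low by simp
  qed
  then obtain j where j: "j < n" "j \<noteq> s" "bad_pair s j" by blast
  have "card ({..<n} - {s,j}) \<le> card M"
    using card_goods card_mono[of "{..<n}" "{..<n} - {s,j}"] by auto
  then obtain g0 where "config ({..<n} - {s,j}) g0"
    unfolding config_def using inj_on_iff_card_le[of "{..<n} - {s,j}" M] finite_goods by auto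
  then obtain g where g: "pareto ({..<n} - {s,j}) g" using pareto_exists by blast
  obtain t where t: "t \<in> M - g ` ({..<n} - {s,j})"
    "dominant s (M - g ` ({..<n} - {s,j})) t" "dominant j (M - g ` ({..<n} - {s,j})) t"
    using bad_pair_dominant[OF s j(1) _ j(3) g] j(2) by metis
  \<comment> \<open>Collecting only the goods \<open>t\<close> gives a finite set to minimize over,
    whatever the assignments \<open>g\<close> are.\<close>
  define B where "B = {t \<in> M. \<exists>j g. blocked n M v s j g t}"
  have "blocked n M v s j g t"
    using s j g t by unfold_locales auto
  then have "t \<in> B" unfolding B_def using t by auto
  have fin: "finite B" unfolding B_def using finite_goods by simp
  then have "Min (u s ` B) \<in> u s ` B" using \<open>t \<in> B\<close> by (intro Min_in) auto
  then obtain t0 where t0: "t0 \<in> B" "u s t0 = Min (u s ` B)" by auto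
  have least: "u s t0 \<le> u s t'" if "t' \<in> B" for t' using t0 fin that by simp
  obtain j0 g0 where st: "blocked n M v s j0 g0 t0" using t0 unfolding B_def by blast
  have "\<not> (\<exists>k g' t'. blocked n M v s k g' t' \<and> u s t' < u s t0)"
  proof
    assume "\<exists>k g' t'. blocked n M v s k g' t' \<and> u s t' < u s t0"
    then obtain k g' t' where b: "blocked n M v s k g' t'" "u s t' < u s t0" by blast
    have "t' \<in> B" unfolding B_def using b(1) blocked.t_in[OF b(1)] by blast
    then show False using least b(2) by fastforce
  qed
  then show ?thesis using blocked.partner_or_descend[OF st low] by blast
qed

text \<open>Agents in \<open>D\<close> contribute at least 1 each. Every other agent contributes at
  least 2, plus 1 for each member of \<open>D\<close> it serves. The total is at least
  \<open>2 * n\<close>, that is, twice the required number of allocations.\<close>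

lemma card_proper_ge_3_agents:
  assumes n: "n \<ge> 3"
  shows "card proper \<ge> n"
proof -
  define D where "D = {i \<in> {..<n}. surplus i \<le> 1}"
  have "\<forall>d\<in>D. \<exists>k Y Z. k < n \<and> k \<noteq> d \<and> Y \<in> proper \<and> card (Y d) = 2 \<and> card (Y k) = 2 \<and>
      Z \<in> proper \<and> card (Z k) = 3"
    using deficient_partner n unfolding D_def by auto
  then obtain k Y Z where kYZ: "\<And>d. d \<in> D \<Longrightarrow> k d < n \<and> k d \<noteq> d \<and> Y d \<in> proper \<and>
      card (Y d d) = 2 \<and> card (Y d (k d)) = 2 \<and> Z d \<in> proper \<and> card (Z d (k d)) = 3"
    by metis
  define r where "r i = card {d \<in> D. k d = i}" for i
  have finD: "finite D" and DN: "D \<subseteq> {..<n}" unfolding D_def by auto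
  have kD: "k d \<in> {..<n} - D" if "d \<in> D" for d
    using surplus_ge_triple[of "Z d" "k d"] kYZ[OF that] unfolding D_def by auto
  have inD: "1 \<le> surplus d" if "d \<in> D" for d
    using surplus_ge_sum[of "{Y d}" d] kYZ[OF that] by simp
  have notD: "2 + r i \<le> surplus i" if i: "i \<in> {..<n} - D" for i
  proof (cases "{d \<in> D. k d = i} = {}")
    case True
    then have "r i = 0" unfolding r_def by (metis card.empty)
    then show ?thesis using i unfolding D_def by auto
  next
    case False
    define F where "F = {d \<in> D. k d = i}"
    obtain e where e: "e \<in> D" "k e = i" using False by auto
    have finF: "finite F" unfolding F_def using finD by simp
    \<comment> \<open>If \<open>c\<close> and \<open>d\<close> shared one allocation, then
      \<open>c\<close>, \<open>d\<close> and \<open>i\<close> would all hold pairs in it.\<close>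
    have injY: "inj_on Y F"
    proof (rule inj_onI, rule ccontr)
      fix c d assume cd: "c \<in> F" "d \<in> F" "Y c = Y d" "c \<noteq> d"
      then have "c \<in> D" "d \<in> D" "k c = i" "k d = i" unfolding F_def by auto
      then show False
        using no_three_large[of "Y c" c i d] kYZ[of c] kYZ[of d] cd DN by auto
    qed
    have YF: "card (X i) = 2" "X \<in> proper" if "X \<in> Y ` F" for X
      using that kYZ unfolding F_def by auto
    have Ze: "Z e \<in> proper" "card (Z e i) = 3" using kYZ[OF e(1)] e(2) by auto
    have "Z e \<notin> Y ` F" using YF(1)[of "Z e"] Ze by auto
    then have "(\<Sum>X\<in>insert (Z e) (Y ` F). card (X i) - 1) = 2 + (\<Sum>X\<in>Y ` F. card (X i) - 1)"
      using finF Ze by simp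
    also have "(\<Sum>X\<in>Y ` F. card (X i) - 1) = (\<Sum>X\<in>Y ` F. 1)"
      using YF by (intro sum.cong) auto
    also have "\<dots> = r i" using card_image[OF injY] unfolding r_def F_def by simp
    finally show ?thesis using surplus_ge_sum[of "insert (Z e) (Y ` F)" i] YF Ze by auto
  qed
  have "(\<Sum>i\<in>{..<n} - D. r i) = card D"
  proof -
    have "(\<Sum>i\<in>{..<n} - D. \<Sum>d\<in>{d \<in> D. k d = i}. 1) = (\<Sum>d\<in>D. 1::nat)"
      by (rule sum.group) (use finD kD in auto)
    then show ?thesis unfolding r_def by simp
  qed
  moreover have "card ({..<n} - D) + card D = n"
    using card_Diff_subset[OF finD DN] card_mono[OF _ DN] by simp
  moreover have "2 * card ({..<n} - D) + (\<Sum>i\<in>{..<n} - D. r i) = (\<Sum>i\<in>{..<n} - D. 2 + r i)"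
    unfolding sum.distrib by simp
  moreover have "(\<Sum>i\<in>{..<n} - D. 2 + r i) \<le> (\<Sum>i\<in>{..<n} - D. surplus i)"
    by (rule sum_mono) (rule notD)
  moreover have "card D \<le> (\<Sum>i\<in>D. surplus i)"
    using sum_mono[of D "\<lambda>_. 1" surplus] inD by simp
  moreover have "(\<Sum>i<n. surplus i) = (\<Sum>i\<in>{..<n} - D. surplus i) + (\<Sum>i\<in>D. surplus i)"
    by (rule sum.subset_diff[OF DN]) simp
  ultimately show ?thesis using sum_surplus by linarith
qed

text \<open>With different favourites, the other two goods can be distributed in two ways. With a
  common favourite \<open>t\<close>, each agent is given a turn to choose between \<open>t\<close>
  alone and a better pair without \<open>t\<close>, and the two outcomes differ.\<close>

lemma card_proper_2_agents:
  assumes n: "n = 2"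
  shows "card proper \<ge> 2"
proof -
  have N: "{..<n} = {0,1}" using n by auto
  have M4: "card M = 4" using card_goods n by simp
  have two: "card proper \<ge> 2" if "X \<in> proper" "Y \<in> proper" "X \<noteq> Y" for X Y
    using card_mono[OF finite_proper, of "{X,Y}"] that by simp
  have pair: "\<exists>X\<in>proper. X a = P \<and> X b = Q"
    if ab: "{a,b} = {0,1}" and PQ: "P \<union> Q = M" "P \<inter> Q = {}" "card P = 2" "card Q = 2"
      "\<And>h. h \<in> Q \<Longrightarrow> u a h \<le> v a P" "\<And>h. h \<in> P \<Longrightarrow> u b h \<le> v b Q" for a b :: nat and P Q
  proof -
    have *: "a < n" "b < n" "a \<noteq> b" using ab N by (auto simp: doubleton_eq_iff)
    have none: "{..<n} - {a,b} = {}" using ab N by auto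
    have "config ({..<n} - {a,b}) f" "P \<union> Q = M - f ` ({..<n} - {a,b})" for f
      unfolding config_def none using PQ by auto
    \<comment> \<open>\<open>undefined\<close> is never handed to anyone, since \<open>a\<close> and
      \<open>b\<close> are the only agents.\<close>
    then have "(\<lambda>i. if i = a then P else if i = b then Q else if i < n then {undefined} else {}) \<in> proper"
      by (rule two_pairs_proper[OF * _ _ PQ(2-4) _ PQ(5,6)]) (use ab N in auto)
    then show ?thesis by (rule bexI[rotated]) (use *(3) in simp)
  qed
  have ne: "M \<noteq> {}" using M4 by auto
  obtain t where t: "t \<in> M" "\<And>h. h \<in> M \<Longrightarrow> u 0 h \<le> u 0 t" using obtain_top[OF subset_refl ne] by blast
  obtain t' where t': "t' \<in> M" "\<And>h. h \<in> M \<Longrightarrow> u 1 h \<le> u 1 t'" using obtain_top[OF subset_refl ne] by blast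
  show ?thesis
  proof (cases "t = t'")
    case False
    have "card (M - {t,t'}) = 2" using M4 t t' False finite_goods by simp
    then obtain x y where xy: "M - {t,t'} = {x,y}" "x \<noteq> y" by (meson card_2_iff)
    then have M: "M = {t,t',x,y}" and d: "t \<noteq> x" "t \<noteq> y" "t' \<noteq> x" "t' \<noteq> y" using t t' by auto
    have top0: "u 0 h \<le> v 0 {t,z}" if "h \<in> M" "z \<in> M" for h z
      using t(2)[OF that(1)] u_le_bundle[of 0 t "{t,z}"] t(1) that n by fastforce
    have top1: "u 1 h \<le> v 1 {t',z}" if "h \<in> M" "z \<in> M" for h z
      using t'(2)[OF that(1)] u_le_bundle[of 1 t' "{t',z}"] t'(1) that n by fastforce
    have "\<exists>X\<in>proper. X 0 = {t,x} \<and> X 1 = {t',y}"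
      by (rule pair) (use M d False xy top0 top1 in auto)
    moreover have "\<exists>X\<in>proper. X 0 = {t,y} \<and> X 1 = {t',x}"
      by (rule pair) (use M d False xy top0 top1 in auto)
    ultimately obtain X Y where "X \<in> proper" "Y \<in> proper" "X 0 = {t,x}" "Y 0 = {t,y}" by blast
    then show ?thesis using two[of X Y] d xy by (metis doubleton_eq_iff)
  next
    case True
    have best: "\<exists>X\<in>proper. X a = {t} \<or> t \<in> X b \<and> card (X b) = 2"
      if ab: "{a,b} = {0,1}" for a b :: nat
    proof (cases "\<forall>P. P \<subseteq> M - {t} \<and> card P = 2 \<longrightarrow> v a P \<le> u a t")
      case True
      have *: "b < n" "a < n" "a \<noteq> b" "{..<n} - {b} = {a}" using ab N by (auto simp: doubleton_eq_iff)
      have "(\<lambda>i. if i = b then M - {t} else if i < n then {t} else {}) \<in> proper"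
      proof (rule triple_proper(1)[where g = "\<lambda>_. t"])
        show "config ({..<n} - {b}) (\<lambda>_. t)" unfolding *(4) config_def using t by simp
        show "M - {t} = M - (\<lambda>_. t) ` ({..<n} - {b})" unfolding *(4) by simp
        fix i T assume "i < n" "i \<noteq> b" and T: "T \<subseteq> M - {t}" "card T = 2"
        then have "i = a" using *(4) by blast
        then show "v i T \<le> u i t" using True T by blast
      qed (rule *(1))
      then show ?thesis by (rule bexI[rotated]) (use *(2,3) in simp)
    next
      case False
      then obtain P where P: "P \<subseteq> M - {t}" "card P = 2" "u a t < v a P" by (auto simp: not_le)
      have PM: "P \<subseteq> M" using P by auto
      have c: "card (M - P) = 2" using P PM M4 finite_goods by (simp add: card_Diff_subset finite_subset)
      have *: "b < n" "a < n" "a = 0 \<and> b = 1 \<or> a = 1 \<and> b = 0"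
        using ab N by (auto simp: doubleton_eq_iff)
      have topa: "u a h \<le> u a t" "u b h \<le> u b t" if "h \<in> M" for h
        using t(2)[OF that] t'(2)[OF that] \<open>t = t'\<close> *(3) by auto
      have "\<exists>X\<in>proper. X a = P \<and> X b = M - P"
      proof (rule pair[OF ab])
        show "u a h \<le> v a P" if "h \<in> M - P" for h using topa(1)[of h] that P(3) by auto
        show "u b h \<le> v b (M - P)" if "h \<in> P" for h
          using topa(2)[of h] u_le_bundle[OF *(1), of t "M - P"] that P t PM by force
      qed (use PM P c in auto)
      then obtain X where X: "X \<in> proper" "X b = M - P" by blast
      have "t \<in> M - P" using t P by auto
      then show ?thesis using X c by metis
    qed
    obtain X where X: "X \<in> proper" "X 0 = {t} \<or> t \<in> X 1 \<and> card (X 1) = 2"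
      using best[of 0 1] by blast
    obtain Y where Y: "Y \<in> proper" "Y 1 = {t} \<or> t \<in> Y 0 \<and> card (Y 0) = 2"
      using best[of 1 0, OF insert_commute] by blast
    have "X 0 \<inter> X 1 = {}"
      using X(1) n unfolding proper_def EFX_allocations_def is_allocation_def by auto
    \<comment> \<open>A common allocation would put \<open>t\<close> into both bundles or make
      \<open>{t}\<close> a pair.\<close>
    then have "X \<noteq> Y" using X(2) Y(2) by auto
    then show ?thesis using two X Y by blast
  qed
qed

lemma card_proper: "card proper \<ge> n"
proof -
  consider "n = 0" | "n = 1" | "n = 2" | "n \<ge> 3" by linarith
  then show ?thesis
  proof cases
    case 2
    then have none: "{..<n} - {0} = {}" by auto
    have "config ({..<n} - {0}) f" "M = M - f ` ({..<n} - {0})" for f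
      unfolding config_def none by simp_all
    then have "(\<lambda>i. if i = 0 then M else if i < n then {undefined} else {}) \<in> proper"
      by (rule triple_proper(1)[rotated]) (use 2 in auto)
    then have "card proper > 0" using finite_proper card_gt_0_iff by blast
    then show ?thesis using 2 by simp
  qed (use card_proper_2_agents card_proper_ge_3_agents in auto)
qed

end

section \<open>Breaking ties and returning to arbitrary monotone valuations\<close>

text \<open>A small additive term breaks ties between goods without reversing any strict preference.\<close>

lemma strict_refinement:
  fixes f :: "'g set \<Rightarrow> real"
  assumes fin: "finite M" and mono: "monotone_valuation M f"
  shows "\<exists>w. monotone_valuation M w \<and> inj_on (\<lambda>h. w {h}) M \<and>
    (\<forall>S T. S \<subseteq> M \<and> T \<subseteq> M \<and> w S \<le> w T \<longrightarrow> f S \<le> f T)"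
proof -
  obtain idx :: "'g \<Rightarrow> nat" where idx: "inj_on idx M"
    using finite_imp_inj_to_nat_seg[OF fin] by blast
  define b where "b S = real (\<Sum>h\<in>S. idx h)" for S
  have b_mono: "b S \<le> b T" if "S \<subseteq> T" "T \<subseteq> M" for S T
    unfolding b_def using that fin by (intro of_nat_mono sum_mono2) (auto intro: finite_subset)
  have b_nonneg: "0 \<le> b S" for S unfolding b_def by (rule of_nat_0_le_iff)
  \<comment> \<open>\<open>D\<close> holds the positive gaps between values of \<open>f\<close>; the
    extra 1 keeps it nonempty when \<open>f\<close> is constant.\<close>
  define D where "D = insert 1 ((\<lambda>(S, T). f T - f S) ` {(S, T). S \<subseteq> M \<and> T \<subseteq> M \<and> f S < f T})"
  have finD: "finite D"
  proof -
    have "finite {(S, T). S \<subseteq> M \<and> T \<subseteq> M \<and> f S < f T}"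
      by (rule finite_subset[of _ "Pow M \<times> Pow M"]) (use fin in auto)
    then show ?thesis unfolding D_def by simp
  qed
  have "\<forall>x\<in>D. x > 0" unfolding D_def by auto
  moreover have "D \<noteq> {}" unfolding D_def by simp
  ultimately have pos: "Min D > 0" using finD by simp
  \<comment> \<open>The total bonus \<open>\<epsilon> * b M\<close> stays strictly below the
    smallest gap; the \<open>+ 1\<close> ensures this and keeps the denominator positive.\<close>
  define \<epsilon> where "\<epsilon> = Min D / (b M + 1)"
  have eps: "\<epsilon> > 0" "\<epsilon> * (b M + 1) = Min D"
    unfolding \<epsilon>_def using pos b_nonneg[of M] by (auto simp: field_simps add_pos_nonneg)
  define w where "w S = f S + \<epsilon> * b S" for S
  have strict: "w S < w T" if ST: "S \<subseteq> M" "T \<subseteq> M" "f S < f T" for S T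
  proof -
    have "f T - f S \<in> D" unfolding D_def using ST by auto
    then have "Min D \<le> f T - f S" using finD by simp
    moreover have "\<epsilon> * b S \<le> \<epsilon> * b M" using b_mono[of S M] ST eps by simp
    moreover have "0 \<le> \<epsilon> * b T" using b_nonneg eps by simp
    moreover have "\<epsilon> * b M < Min D" using eps by (simp add: algebra_simps)
    ultimately show ?thesis unfolding w_def by linarith
  qed
  have "monotone_valuation M w"
    unfolding monotone_valuation_def w_def
  proof (intro allI impI)
    fix S T assume "S \<subseteq> T \<and> T \<subseteq> M"
    then have "f S \<le> f T" "b S \<le> b T" using mono b_mono unfolding monotone_valuation_def by auto
    then show "f S + \<epsilon> * b S \<le> f T + \<epsilon> * b T" using eps by (simp add: add_mono)
  qed
  moreover have "inj_on (\<lambda>h. w {h}) M"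
  proof (rule inj_onI)
    fix h k assume hk: "h \<in> M" "k \<in> M" "w {h} = w {k}"
    then have "f {h} = f {k}" using strict[of "{h}" "{k}"] strict[of "{k}" "{h}"] by fastforce
    then have "idx h = idx k" using hk eps unfolding w_def b_def by simp
    then show "h = k" using idx hk by (meson inj_onD)
  qed
  ultimately show ?thesis using strict by (meson not_le)
qed

theorem theorem6:
  fixes n :: nat and M :: "'g set" and v :: "nat \<Rightarrow> 'g set \<Rightarrow> real"
  assumes "finite M" and "card M = n + 2"
    and "\<And>i. i < n \<Longrightarrow> monotone_valuation M (v i)"
  shows "card (EFX_allocations n M v) \<ge> n"
proof -
  have "\<forall>i. \<exists>w. i < n \<longrightarrow> monotone_valuation M w \<and> inj_on (\<lambda>h. w {h}) M \<and>
    (\<forall>S T. S \<subseteq> M \<and> T \<subseteq> M \<and> w S \<le> w T \<longrightarrow> v i S \<le> v i T)"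
    using strict_refinement[OF assms(1) assms(3)] by blast
  then obtain w where w: "\<And>i. i < n \<Longrightarrow> monotone_valuation M (w i) \<and> inj_on (\<lambda>h. w i {h}) M \<and>
    (\<forall>S T. S \<subseteq> M \<and> T \<subseteq> M \<and> w i S \<le> w i T \<longrightarrow> v i S \<le> v i T)" by metis
  interpret strict_instance n M w by unfold_locales (use assms w in blast)+
  \<comment> \<open>Every weak comparison under \<open>w\<close> also holds under \<open>v\<close>,
    so it suffices to count for the tie-free \<open>w\<close>.\<close>
  have "EFX_allocations n M w \<subseteq> EFX_allocations n M v"
  proof
    fix X assume "X \<in> EFX_allocations n M w"
    then have al: "is_allocation n M X" and "EFX n w X" unfolding EFX_allocations_def by auto
    then have "v i (X k - {h}) \<le> v i (X i)" if "i < n" "k < n" "h \<in> X k" for i k h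
      using w[OF that(1)] that unfolding EFX_def is_allocation_def by (meson Diff_subset subset_trans)
    then show "X \<in> EFX_allocations n M v" using al unfolding EFX_allocations_def EFX_def by blast
  qed
  moreover have "proper \<subseteq> EFX_allocations n M w" unfolding proper_def by auto
  moreover have "finite (EFX_allocations n M v)" using assms(1) by (rule finite_EFX_allocations)
  ultimately have "card proper \<le> card (EFX_allocations n M v)" by (meson card_mono subset_trans)
  then show ?thesis using card_proper by linarith
qed

end
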